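(* Let $T: B(\ell^2)\to B(\ell^2)$ be a linear bijection. Then $T$ is contractive and Schur multiplicative if and only if there are permutation unitaries $u,v$ in $B(\ell^2)$ such that either $T(a)=uav$ for all $a\in B(\ell^2)$, or $T(a)=ua^tv$ for all $a\in B(\ell^2)$.
   Context: $B(\ell^2)$ is the space of bounded linear operators on the complex Hilbert space $\ell^2=\ell^2(\mathbb{N})$, with the operator norm. Using the canonical orthonormal basis $\{e_i\}_{i=1}^\infty$, each $a\in B(\ell^2)$ is identified with the infinite matrix $[a_{ij}]_{i,j\in\mathbb{N}}$, $a_{ij}=(ae_j,e_i)$. The Schur product of $a,b\in B(\ell^2)$ is the operator $a\ast b\in B(\ell^2)$ with matrix $[a_{ij}b_{ij}]$ (it is well known that this is again a bounded operator). A linear map $T$ on $B(\ell^2)$ is Schur multiplicative if $T(a)\ast T(b)=T(a\ast b)$ for all $a,b\in B(\ell^2)$. $T$ is contractive if its operator norm as a linear map on the normed space $B(\ell^2)$ satisfies $\|T\|_{\mathrm{op}}\le1$. $a^t$ denotes the transpose of $a$, the operator with matrix $[a_{ji}]$. A permutation unitary in $B(\ell^2)$ is a unitary that permutes the canonical basis, i.e. $ue_i=e_{\pi(i)}$ for all $i$, for some permutation $\pi$ of $\mathbb{N}$. Products such as $uav$ are compositions of operators. *)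

theory Defs
  imports "HOL-Analysis.Analysis"
begin

class complex_vector = ab_group_add +
  fixes scaleC :: "complex \<Rightarrow> 'a \<Rightarrow> 'a" (infixr \<open>*\<^sub>C\<close> 75)
  assumes scaleC_add_right: "c *\<^sub>C (x + y) = c *\<^sub>C x + c *\<^sub>C y"
    and scaleC_add_left: "(c + d) *\<^sub>C x = c *\<^sub>C x + d *\<^sub>C x"
    and scaleC_scaleC: "c *\<^sub>C d *\<^sub>C x = (c * d) *\<^sub>C x"
    and scaleC_one: "1 *\<^sub>C x = x"

lemma vector_space_scaleC: "vector_space (scaleC :: complex \<Rightarrow> 'a \<Rightarrow> 'a::complex_vector)"
  by unfold_locales (auto simp: scaleC_add_right scaleC_add_left scaleC_scaleC scaleC_one)

lemma scaleC_minus_right: "c *\<^sub>C (- x) = - (c *\<^sub>C (x :: 'a::complex_vector))"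
proof -
  have "c *\<^sub>C 0 = (0 :: 'a)"
    using scaleC_add_right[of c "0 :: 'a" 0] by simp
  hence "c *\<^sub>C (- x) + c *\<^sub>C x = 0"
    by (simp flip: scaleC_add_right)
  thus ?thesis by (rule eq_neg_iff_add_eq_0[THEN iffD2])
qed

lemma scaleC_diff_right: "c *\<^sub>C (x - y) = c *\<^sub>C x - c *\<^sub>C (y :: 'a::complex_vector)"
  using scaleC_add_right[of c x "- y"] by (simp add: scaleC_minus_right)

abbreviation complex_linear :: "('a::complex_vector \<Rightarrow> 'b::complex_vector) \<Rightarrow> bool" where
  "complex_linear \<equiv> Vector_Spaces.linear scaleC scaleC"


section \<open>The Hilbert space of square-summable complex sequences\<close>

typedef ell2 = "{x :: nat \<Rightarrow> complex. summable (\<lambda>n. (cmod (x n))\<^sup>2)}"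
  morphisms coord Abs_ell2
  by (rule exI[of _ "\<lambda>_. 0"]) simp

setup_lifting type_definition_ell2

lemma summable_coord: "summable (\<lambda>n. (cmod (coord x n))\<^sup>2)"
  using coord by blast

lemma ell2_eqI: "(\<And>n. coord x n = coord y n) \<Longrightarrow> x = y"
  by (metis coord_inject ext)

lemma square_summable_prod:
  fixes x y :: "nat \<Rightarrow> complex"
  assumes "summable (\<lambda>n. (cmod (x n))\<^sup>2)" "summable (\<lambda>n. (cmod (y n))\<^sup>2)"
  shows "summable (\<lambda>n. cmod (x n) * cmod (y n))"
proof (rule summable_comparison_test')
  show "summable (\<lambda>n. (cmod (x n))\<^sup>2 + (cmod (y n))\<^sup>2)"
    using assms by (rule summable_add)
  fix n :: nat
  have "0 \<le> (cmod (x n) - cmod (y n))\<^sup>2" by simp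
  hence "2 * (cmod (x n) * cmod (y n)) \<le> (cmod (x n))\<^sup>2 + (cmod (y n))\<^sup>2"
    by (simp add: power2_diff)
  moreover have "0 \<le> cmod (x n) * cmod (y n)" by simp
  ultimately show "norm (cmod (x n) * cmod (y n)) \<le> (cmod (x n))\<^sup>2 + (cmod (y n))\<^sup>2"
    by (simp only: real_norm_def abs_of_nonneg)
qed

lemma square_summable_add:
  fixes x y :: "nat \<Rightarrow> complex"
  assumes "summable (\<lambda>n. (cmod (x n))\<^sup>2)" "summable (\<lambda>n. (cmod (y n))\<^sup>2)"
  shows "summable (\<lambda>n. (cmod (x n + y n))\<^sup>2)"
proof (rule summable_comparison_test')
  show "summable (\<lambda>n. (cmod (x n))\<^sup>2 + 2 * (cmod (x n) * cmod (y n)) + (cmod (y n))\<^sup>2)"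
    using assms square_summable_prod[OF assms] by (intro summable_add summable_mult)
  fix n :: nat
  have "(cmod (x n + y n))\<^sup>2 \<le> (cmod (x n) + cmod (y n))\<^sup>2"
    by (intro power_mono norm_triangle_ineq norm_ge_zero)
  thus "norm ((cmod (x n + y n))\<^sup>2)
      \<le> (cmod (x n))\<^sup>2 + 2 * (cmod (x n) * cmod (y n)) + (cmod (y n))\<^sup>2"
    by (simp add: power2_sum algebra_simps)
qed

lemma square_summable_scale:
  fixes x :: "nat \<Rightarrow> complex"
  assumes "summable (\<lambda>n. (cmod (x n))\<^sup>2)"
  shows "summable (\<lambda>n. (cmod (c * x n))\<^sup>2)"
  using summable_mult[OF assms, of "(cmod c)\<^sup>2"] by (simp add: norm_mult power_mult_distrib)

instantiation ell2 :: complex_vector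
begin
lift_definition zero_ell2 :: ell2 is "\<lambda>_. 0" by simp
lift_definition plus_ell2 :: "ell2 \<Rightarrow> ell2 \<Rightarrow> ell2" is "\<lambda>x y n. x n + y n"
  by (rule square_summable_add)
lift_definition uminus_ell2 :: "ell2 \<Rightarrow> ell2" is "\<lambda>x n. - x n" by simp
lift_definition minus_ell2 :: "ell2 \<Rightarrow> ell2 \<Rightarrow> ell2" is "\<lambda>x y n. x n - y n"
  using square_summable_add[of _ "\<lambda>n. - y n" for y] by fastforce
lift_definition scaleC_ell2 :: "complex \<Rightarrow> ell2 \<Rightarrow> ell2" is "\<lambda>c x n. c * x n"
  by (rule square_summable_scale)
instance
  by standard (transfer; simp add: fun_eq_iff algebra_simps)+
end

lemma summable_inner_coord: "summable (\<lambda>n. coord x n \<bullet> coord y n)"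
  by (rule summable_comparison_test'[OF square_summable_prod[OF summable_coord[of x] summable_coord[of y]]])
     (simp add: Cauchy_Schwarz_ineq2)

instantiation ell2 :: real_inner
begin
definition scaleR_ell2 :: "real \<Rightarrow> ell2 \<Rightarrow> ell2" where
  "scaleR_ell2 r x = complex_of_real r *\<^sub>C x"
definition inner_ell2 :: "ell2 \<Rightarrow> ell2 \<Rightarrow> real" where
  "inner_ell2 x y = (\<Sum>n. coord x n \<bullet> coord y n)"
definition norm_ell2 :: "ell2 \<Rightarrow> real" where
  "norm_ell2 x = sqrt (\<Sum>n. (cmod (coord x n))\<^sup>2)"
definition sgn_ell2 :: "ell2 \<Rightarrow> ell2" where
  "sgn_ell2 x = scaleR (inverse (norm x)) x"
definition dist_ell2 :: "ell2 \<Rightarrow> ell2 \<Rightarrow> real" where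
  "dist_ell2 x y = norm (x - y)"
definition uniformity_ell2 :: "(ell2 \<times> ell2) filter" where
  "uniformity_ell2 = (INF e\<in>{0<..}. principal {(x, y). dist x y < e})"
definition open_ell2 :: "ell2 set \<Rightarrow> bool" where
  "open_ell2 U \<longleftrightarrow> (\<forall>x\<in>U. \<forall>\<^sub>F (x', y) in uniformity. x' = x \<longrightarrow> y \<in> U)"

instance
proof
  fix x y z :: ell2 and r s :: real and U :: "ell2 set"
  show "r *\<^sub>R (x + y) = r *\<^sub>R x + r *\<^sub>R y" "(r + s) *\<^sub>R x = r *\<^sub>R x + s *\<^sub>R x"
    "r *\<^sub>R s *\<^sub>R x = (r * s) *\<^sub>R x" "1 *\<^sub>R x = x"
    by (simp_all add: scaleR_ell2_def scaleC_add_right scaleC_add_left scaleC_scaleC scaleC_one)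
  show "sgn x = scaleR (inverse (norm x)) x" "dist x y = norm (x - y)"
    "uniformity = (INF e\<in>{0<..}. principal {(x::ell2, y). dist x y < e})"
    "open U \<longleftrightarrow> (\<forall>x\<in>U. \<forall>\<^sub>F (x', y) in uniformity. x' = x \<longrightarrow> y \<in> U)"
    by (rule sgn_ell2_def dist_ell2_def uniformity_ell2_def open_ell2_def)+
  show "x \<bullet> y = y \<bullet> x"
    by (simp add: inner_ell2_def inner_commute)
  show "(x + y) \<bullet> z = x \<bullet> z + y \<bullet> z"
    by (simp add: inner_ell2_def plus_ell2.rep_eq inner_add_left suminf_add summable_inner_coord)
  have "coord (r *\<^sub>R x) n = r *\<^sub>R coord x n" for n
    by (simp add: scaleR_ell2_def scaleC_ell2.rep_eq scaleR_conv_of_real)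
  thus "(r *\<^sub>R x) \<bullet> y = r * (x \<bullet> y)"
    by (simp add: inner_ell2_def suminf_mult summable_inner_coord)
  show "0 \<le> x \<bullet> x"
    by (simp add: inner_ell2_def suminf_nonneg summable_inner_coord)
  have "x \<bullet> x = 0 \<longleftrightarrow> (\<forall>n. coord x n \<bullet> coord x n = 0)"
    unfolding inner_ell2_def by (rule suminf_eq_zero_iff) (simp_all add: summable_inner_coord)
  also have "\<dots> \<longleftrightarrow> x = 0"
    by (auto intro!: ell2_eqI simp: zero_ell2.rep_eq)
  finally show "x \<bullet> x = 0 \<longleftrightarrow> x = 0" .
  show "norm x = sqrt (x \<bullet> x)"
    by (simp add: norm_ell2_def inner_ell2_def power2_norm_eq_inner)
qed
end

text \<open>The complex inner product is linear in its first argument.\<close>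

definition cinner :: "ell2 \<Rightarrow> ell2 \<Rightarrow> complex" where
  "cinner x y = (\<Sum>n. coord x n * cnj (coord y n))"

lift_definition unit_vec :: "nat \<Rightarrow> ell2" is "\<lambda>i n. if n = i then 1 else 0"
  by (rule summable_finite[of "{i}" for i]) auto

lemma summable_cinner: "summable (\<lambda>n. coord x n * cnj (coord y n))"
  by (rule summable_norm_cancel)
     (simp add: norm_mult square_summable_prod summable_coord)

lemma cinner_unit_vec: "cinner x (unit_vec i) = coord x i"
proof -
  have "cinner x (unit_vec i) = (\<Sum>n\<in>{i}. coord x n * cnj (coord (unit_vec i) n))"
    unfolding cinner_def by (rule suminf_finite) (auto simp: unit_vec.rep_eq)
  thus ?thesis by (simp add: unit_vec.rep_eq)
qed

lemma inner_eq_Re_cinner: "x \<bullet> y = Re (cinner x y)"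
  by (simp add: inner_ell2_def cinner_def Re_suminf summable_cinner inner_complex_def)

lemma norm_scaleC_ell2: "norm (c *\<^sub>C x) = cmod c * norm (x :: ell2)"
  by (simp add: norm_ell2_def scaleC_ell2.rep_eq norm_mult power_mult_distrib suminf_mult
      summable_coord real_sqrt_mult)

lemma norm_coord_le: "cmod (coord x i) \<le> norm x"
proof -
  have "(\<Sum>n\<in>{i}. (cmod (coord x n))\<^sup>2) \<le> (\<Sum>n. (cmod (coord x n))\<^sup>2)"
    by (rule sum_le_suminf) (simp_all add: summable_coord)
  thus ?thesis
    unfolding norm_ell2_def by (intro real_le_rsqrt) simp
qed

lemma norm_ell2_sq: "(norm x)\<^sup>2 = (\<Sum>n. (cmod (coord x n))\<^sup>2)"
  by (simp add: norm_ell2_def suminf_nonneg summable_coord)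


lifting_forget ell2.lifting


section \<open>Bounded operators\<close>

text \<open>
  The library type \<open>ell2 \<Rightarrow>\<^sub>L ell2\<close> consists of the bounded real-linear maps; the operators are those
  that are complex-homogeneous. The norm is the operator norm of that type.
\<close>

typedef bop = "{a :: ell2 \<Rightarrow>\<^sub>L ell2. \<forall>c x. blinfun_apply a (c *\<^sub>C x) = c *\<^sub>C blinfun_apply a x}"
  morphisms blinfun_of_bop Abs_bop
  by (rule exI[of _ 0]) (simp add: scaleC_ell2_def zero_ell2_def Abs_ell2_inverse)

setup_lifting type_definition_bop

lift_definition app :: "bop \<Rightarrow> ell2 \<Rightarrow> ell2" is blinfun_apply .

lift_definition blinfun_scaleC :: "complex \<Rightarrow> ell2 \<Rightarrow>\<^sub>L ell2" is "\<lambda>c x. c *\<^sub>C x"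
  by (rule bounded_linear_intro[of _ "cmod c" for c])
     (auto simp: scaleC_add_right scaleR_ell2_def scaleC_scaleC norm_scaleC_ell2 mult.commute)

instantiation bop :: complex_vector
begin
lift_definition zero_bop :: bop is 0
  by (simp add: scaleC_ell2_def zero_ell2_def Abs_ell2_inverse)
lift_definition plus_bop :: "bop \<Rightarrow> bop \<Rightarrow> bop" is "(+)"
  by (simp add: blinfun.add_left scaleC_add_right)
lift_definition uminus_bop :: "bop \<Rightarrow> bop" is uminus
  by (simp add: blinfun.minus_left scaleC_minus_right)
lift_definition minus_bop :: "bop \<Rightarrow> bop \<Rightarrow> bop" is "(-)"
  by (simp add: blinfun.diff_left scaleC_diff_right)
lift_definition scaleC_bop :: "complex \<Rightarrow> bop \<Rightarrow> bop" is "\<lambda>c a. blinfun_scaleC c o\<^sub>L a"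
  by (simp add: blinfun_scaleC.rep_eq scaleC_scaleC mult.commute)
instance
proof
  fix a b c :: bop and r s :: complex
  show "a + b + c = a + (b + c)" "a + b = b + a" "0 + a = a" "- a + a = 0" "a - b = a + - b"
    by (transfer; simp)+
  show "r *\<^sub>C (a + b) = r *\<^sub>C a + r *\<^sub>C b" "(r + s) *\<^sub>C a = r *\<^sub>C a + s *\<^sub>C a"
    "r *\<^sub>C s *\<^sub>C a = (r * s) *\<^sub>C a" "1 *\<^sub>C a = a"
    by (transfer; rule blinfun_eqI;
        simp add: blinfun.add_left blinfun_scaleC.rep_eq
          scaleC_add_right scaleC_add_left scaleC_scaleC scaleC_one)+
qed
end

instantiation bop :: real_normed_vector
begin
lift_definition scaleR_bop :: "real \<Rightarrow> bop \<Rightarrow> bop" is scaleR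
  by (simp add: blinfun.scaleR_left scaleR_ell2_def scaleC_scaleC mult.commute)
lift_definition norm_bop :: "bop \<Rightarrow> real" is norm .
definition sgn_bop :: "bop \<Rightarrow> bop" where
  "sgn_bop a = scaleR (inverse (norm a)) a"
definition dist_bop :: "bop \<Rightarrow> bop \<Rightarrow> real" where
  "dist_bop a b = norm (a - b)"
definition uniformity_bop :: "(bop \<times> bop) filter" where
  "uniformity_bop = (INF e\<in>{0<..}. principal {(a, b). dist a b < e})"
definition open_bop :: "bop set \<Rightarrow> bool" where
  "open_bop U \<longleftrightarrow> (\<forall>a\<in>U. \<forall>\<^sub>F (a', b) in uniformity. a' = a \<longrightarrow> b \<in> U)"
instance
proof
  fix a b :: bop and r s :: real and U :: "bop set"
  show "sgn a = scaleR (inverse (norm a)) a" "dist a b = norm (a - b)"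
    "uniformity = (INF e\<in>{0<..}. principal {(a::bop, b). dist a b < e})"
    "open U \<longleftrightarrow> (\<forall>a\<in>U. \<forall>\<^sub>F (a', b) in uniformity. a' = a \<longrightarrow> b \<in> U)"
    by (rule sgn_bop_def dist_bop_def uniformity_bop_def open_bop_def)+
  show "r *\<^sub>R (a + b) = r *\<^sub>R a + r *\<^sub>R b" "(r + s) *\<^sub>R a = r *\<^sub>R a + s *\<^sub>R a"
    "r *\<^sub>R s *\<^sub>R a = (r * s) *\<^sub>R a" "1 *\<^sub>R a = a"
    by (transfer; simp add: scaleR_add_right scaleR_add_left)+
  show "norm a = 0 \<longleftrightarrow> a = 0" "norm (a + b) \<le> norm a + norm b" "norm (r *\<^sub>R a) = \<bar>r\<bar> * norm a"
    by (transfer; simp add: norm_triangle_ineq)+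
qed
end

lift_definition op_compose :: "bop \<Rightarrow> bop \<Rightarrow> bop" (infixl \<open>o\<^sub>B\<close> 70) is blinfun_compose
  by simp

lemma app_op_compose: "app (a o\<^sub>B b) x = app a (app b x)"
  by transfer simp

lemma app_add: "app a (x + y) = app a x + app a y"
  by transfer (simp add: blinfun.add_right)

lemma app_scaleC: "app a (c *\<^sub>C x) = c *\<^sub>C app a x"
  by transfer blast

lemma norm_app_le: "norm (app a x) \<le> norm a * norm x"
  by transfer (rule norm_blinfun)

lemma app_eqI: "(\<And>x. app a x = app b x) \<Longrightarrow> a = b"
  by transfer (rule blinfun_eqI)

lemma norm_bop_eq_onorm: "norm a = onorm (app a)"
  by transfer (rule norm_blinfun.rep_eq)

definition entry :: "bop \<Rightarrow> nat \<Rightarrow> nat \<Rightarrow> complex" where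
  "entry a i j = cinner (app a (unit_vec j)) (unit_vec i)"

definition schur :: "bop \<Rightarrow> bop \<Rightarrow> bop" (infixl \<open>\<^bold>*\<close> 70) where
  "a \<^bold>* b = (THE c. \<forall>i j. entry c i j = entry a i j * entry b i j)"

definition transpose_op :: "bop \<Rightarrow> bop" where
  "transpose_op a = (THE c. \<forall>i j. entry c i j = entry a j i)"

definition schur_multiplicative :: "(bop \<Rightarrow> bop) \<Rightarrow> bool" where
  "schur_multiplicative T \<longleftrightarrow> (\<forall>a b. T a \<^bold>* T b = T (a \<^bold>* b))"

text \<open>Boundedness is required separately, as \<^const>\<open>onorm\<close> is unspecified on unbounded maps.\<close>

definition contractive :: "(bop \<Rightarrow> bop) \<Rightarrow> bool" where
  "contractive T \<longleftrightarrow> bounded_linear T \<and> onorm T \<le> 1"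

definition unitary_op :: "bop \<Rightarrow> bool" where
  "unitary_op u \<longleftrightarrow> surj (app u) \<and> (\<forall>x y. cinner (app u x) (app u y) = cinner x y)"

definition permutation_unitary :: "bop \<Rightarrow> bool" where
  "permutation_unitary u \<longleftrightarrow>
    unitary_op u \<and> (\<exists>\<pi>. bij \<pi> \<and> (\<forall>i. app u (unit_vec i) = unit_vec (\<pi> i)))"


section \<open>Schur products and transposes exist and are unique\<close>

lemma finite_app:
  "coord (app a (\<Sum>j<N. x j *\<^sub>C unit_vec j)) i = (\<Sum>j<N. entry a i j * x j)"
proof (induction N)
  case 0
  have "app a 0 = 0" by transfer (simp add: blinfun.zero_right)
  thus ?case by (simp add: zero_ell2.rep_eq)
next
  case (Suc N)
  thus ?case
    by (simp add: app_add app_scaleC plus_ell2.rep_eq scaleC_ell2.rep_eq entry_def cinner_unit_vec)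
qed

lemma coord_finite:
  "coord (\<Sum>j<N. x j *\<^sub>C unit_vec j) n = (if n < N then x n else 0)"
proof (induction N)
  case 0
  show ?case by (simp add: zero_ell2.rep_eq)
next
  case (Suc N)
  thus ?case
    by (auto simp: plus_ell2.rep_eq scaleC_ell2.rep_eq unit_vec.rep_eq less_Suc_eq)
qed

lemma norm_finite_sq:
  "(norm (\<Sum>j<N. x j *\<^sub>C unit_vec j))\<^sup>2 = (\<Sum>j<N. (cmod (x j))\<^sup>2)"
proof -
  have "(\<Sum>n. (cmod (coord (\<Sum>j<N. x j *\<^sub>C unit_vec j) n))\<^sup>2)
      = (\<Sum>n<N. (cmod (coord (\<Sum>j<N. x j *\<^sub>C unit_vec j) n))\<^sup>2)"
    by (rule suminf_finite) (auto simp: coord_finite)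
  thus ?thesis by (simp add: norm_ell2_sq coord_finite)
qed

lemma finite_expansion_tendsto:
  "(\<lambda>N. \<Sum>j<N. coord x j *\<^sub>C unit_vec j) \<longlonglongrightarrow> x"
proof -
  let ?t = "\<lambda>N. \<Sum>n. (cmod (coord x (n + N)))\<^sup>2"
  have sq: "(norm ((\<Sum>j<N. coord x j *\<^sub>C unit_vec j) - x))\<^sup>2 = ?t N" for N
  proof -
    let ?d = "(\<Sum>j<N. coord x j *\<^sub>C unit_vec j) - x"
    have c: "coord ?d n = (if n < N then 0 else - coord x n)" for n
      by (simp add: minus_ell2.rep_eq coord_finite)
    have "(norm ?d)\<^sup>2 = (\<Sum>n. (cmod (coord ?d (n + N)))\<^sup>2) + (\<Sum>n<N. (cmod (coord ?d n))\<^sup>2)"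
      unfolding norm_ell2_sq by (rule suminf_split_initial_segment) (rule summable_coord)
    thus ?thesis by (simp add: c)
  qed
  have "?t \<longlonglongrightarrow> 0"
    by (rule suminf_exist_split2) (rule summable_coord)
  hence "(\<lambda>N. sqrt (?t N)) \<longlonglongrightarrow> sqrt 0"
    by (rule tendsto_real_sqrt)
  moreover have "sqrt (?t N) = norm ((\<Sum>j<N. coord x j *\<^sub>C unit_vec j) - x)" for N
    by (simp flip: sq)
  ultimately have "(\<lambda>N. norm ((\<Sum>j<N. coord x j *\<^sub>C unit_vec j) - x)) \<longlonglongrightarrow> 0"
    by simp
  thus ?thesis
    by (rule LIM_zero_cancel[OF tendsto_norm_zero_cancel])
qed

lemma app_sums: "(\<lambda>j. entry a i j * coord x j) sums coord (app a x) i"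
  unfolding sums_def
proof (rule LIM_zero_cancel, rule Lim_null_comparison)
  let ?s = "\<lambda>N. \<Sum>j<N. coord x j *\<^sub>C unit_vec j"
  have "norm ((\<Sum>j<N. entry a i j * coord x j) - coord (app a x) i) \<le> norm a * norm (?s N - x)" for N
  proof -
    have "app a (?s N - x) = app a (?s N) - app a x"
      by transfer (simp add: blinfun.diff_right)
    hence "(\<Sum>j<N. entry a i j * coord x j) - coord (app a x) i = coord (app a (?s N - x)) i"
      by (simp add: minus_ell2.rep_eq finite_app)
    thus ?thesis
      using norm_coord_le norm_app_le by (metis order_trans)
  qed
  thus "\<forall>\<^sub>F N in sequentially.
      norm ((\<Sum>j<N. entry a i j * coord x j) - coord (app a x) i) \<le> norm a * norm (?s N - x)"
    by simp
  show "(\<lambda>N. norm a * norm (?s N - x)) \<longlonglongrightarrow> 0"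
    using finite_expansion_tendsto[of x]
    by (intro tendsto_mult_right_zero tendsto_norm_zero LIM_zero)
qed

lemma bop_eqI:
  assumes "\<And>i j. entry a i j = entry b i j"
  shows "a = b"
proof (intro app_eqI ell2_eqI)
  fix x i
  show "coord (app a x) i = coord (app b x) i"
    using app_sums[of a i x] app_sums[of b i x] unfolding assms by (rule sums_unique2)
qed

definition matrix_bound :: "real \<Rightarrow> (nat \<Rightarrow> nat \<Rightarrow> complex) \<Rightarrow> bool" where
  "matrix_bound K m \<longleftrightarrow> (\<forall>x M N.
    (\<Sum>i<M. (cmod (\<Sum>j<N. m i j * x j))\<^sup>2) \<le> K\<^sup>2 * (\<Sum>j<N. (cmod (x j))\<^sup>2))"

lemma matrix_boundD:
  "matrix_bound K m \<Longrightarrow>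
    (\<Sum>i<M. (cmod (\<Sum>j<N. m i j * x j))\<^sup>2) \<le> K\<^sup>2 * (\<Sum>j<N. (cmod (x j))\<^sup>2)"
  by (simp add: matrix_bound_def)

lemma matrix_bound_entry: "matrix_bound (norm a) (entry a)"
  unfolding matrix_bound_def
proof (intro allI)
  fix x :: "nat \<Rightarrow> complex" and M N :: nat
  let ?x = "\<Sum>j<N. x j *\<^sub>C unit_vec j"
  have "(\<Sum>i<M. (cmod (coord (app a ?x) i))\<^sup>2) \<le> (norm (app a ?x))\<^sup>2"
    unfolding norm_ell2_sq by (rule sum_le_suminf) (simp_all add: summable_coord)
  also have "\<dots> \<le> (norm a * norm ?x)\<^sup>2"
    by (intro power_mono norm_app_le norm_ge_zero)
  finally show "(\<Sum>i<M. (cmod (\<Sum>j<N. entry a i j * x j))\<^sup>2)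
      \<le> (norm a)\<^sup>2 * (\<Sum>j<N. (cmod (x j))\<^sup>2)"
    by (simp add: finite_app power_mult_distrib norm_finite_sq)
qed

lemma le_of_sq_le_mult: "0 \<le> s \<Longrightarrow> s\<^sup>2 \<le> k * s \<Longrightarrow> 0 \<le> k \<Longrightarrow> s \<le> (k::real)"
  by (cases "s = 0") (auto simp: power2_eq_square)

lemma matrix_bound_row:
  assumes "matrix_bound K m"
  shows "(\<Sum>j<N. (cmod (m i j))\<^sup>2) \<le> K\<^sup>2"
proof (rule le_of_sq_le_mult)
  let ?s = "\<Sum>j<N. (cmod (m i j))\<^sup>2"
  let ?f = "\<lambda>i'. (cmod (\<Sum>j<N. m i' j * cnj (m i j)))\<^sup>2"
  have eq: "(\<Sum>j<N. m i j * cnj (m i j)) = complex_of_real ?s"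
    by (simp only: complex_norm_square of_real_sum)
  have "?s\<^sup>2 = ?f i"
    unfolding eq by (simp only: norm_of_real power2_abs)
  also have "\<dots> \<le> (\<Sum>i'<Suc i. ?f i')"
    by (rule member_le_sum) auto
  also have "\<dots> \<le> K\<^sup>2 * ?s"
    using matrix_boundD[OF assms, where x = "\<lambda>j. cnj (m i j)" and N = N and M = "Suc i"] by simp
  finally show "?s\<^sup>2 \<le> K\<^sup>2 * ?s" .
qed (simp_all add: sum_nonneg)

lemma matrix_bound_transpose:
  assumes "matrix_bound K m"
  shows "matrix_bound K (\<lambda>i j. m j i)"
  unfolding matrix_bound_def
proof (intro allI)
  fix x :: "nat \<Rightarrow> complex" and M N :: nat
  define t where "t i = (\<Sum>j<N. m j i * x j)" for i
  define r where "r j = (\<Sum>i<M. m j i * cnj (t i))" for j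
  let ?T = "\<Sum>i<M. (cmod (t i))\<^sup>2" and ?X = "\<Sum>j<N. (cmod (x j))\<^sup>2"
  have "complex_of_real ?T = (\<Sum>i<M. t i * cnj (t i))"
    by (simp only: complex_norm_square of_real_sum)
  also have "\<dots> = (\<Sum>i<M. \<Sum>j<N. x j * (m j i * cnj (t i)))"
  proof (rule sum.cong[OF refl])
    fix i
    have "t i * cnj (t i) = (\<Sum>j<N. m j i * x j) * cnj (t i)"
      by (simp only: t_def)
    also have "\<dots> = (\<Sum>j<N. x j * (m j i * cnj (t i)))"
      unfolding sum_distrib_right by (rule sum.cong) (simp_all only: mult_ac)
    finally show "t i * cnj (t i) = (\<Sum>j<N. x j * (m j i * cnj (t i)))" .
  qed
  also have "\<dots> = (\<Sum>j<N. x j * r j)"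
    by (subst sum.swap) (simp add: r_def sum_distrib_left)
  finally have eq: "complex_of_real ?T = (\<Sum>j<N. x j * r j)" .
  have "cmod (complex_of_real ?T) \<le> (\<Sum>j<N. cmod (x j) * cmod (r j))"
    unfolding eq by (intro sum_norm_le) (simp add: norm_mult)
  moreover have T0: "0 \<le> ?T" by (simp add: sum_nonneg)
  ultimately have "?T \<le> (\<Sum>j<N. cmod (x j) * cmod (r j))"
    by (simp only: norm_of_real abs_of_nonneg)
  hence "?T\<^sup>2 \<le> (\<Sum>j<N. cmod (x j) * cmod (r j))\<^sup>2"
    using T0 by (intro power_mono)
  also have "\<dots> \<le> ?X * (\<Sum>j<N. (cmod (r j))\<^sup>2)"
    by (rule Cauchy_Schwarz_ineq_sum)
  also have "\<dots> \<le> ?X * (K\<^sup>2 * (\<Sum>i<M. (cmod (cnj (t i)))\<^sup>2))"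
    unfolding r_def by (intro mult_left_mono matrix_boundD[OF assms] sum_nonneg) simp
  also have "\<dots> = (K\<^sup>2 * ?X) * ?T"
    by (simp only: complex_mod_cnj mult_ac)
  finally have "?T \<le> K\<^sup>2 * ?X"
    by (rule le_of_sq_le_mult[OF T0]) (simp add: sum_nonneg)
  thus "(\<Sum>i<M. (cmod (\<Sum>j<N. m j i * x j))\<^sup>2) \<le> K\<^sup>2 * ?X"
    by (simp only: t_def)
qed

lemma matrix_bound_schur:
  assumes a: "matrix_bound K m" and b: "matrix_bound L n"
  shows "matrix_bound (K * L) (\<lambda>i j. m i j * n i j)"
  unfolding matrix_bound_def
proof (intro allI)
  fix x :: "nat \<Rightarrow> complex" and M N :: nat
  have "(cmod (\<Sum>j<N. m i j * n i j * x j))\<^sup>2 \<le> L\<^sup>2 * (\<Sum>j<N. (cmod (m i j))\<^sup>2 * (cmod (x j))\<^sup>2)" for i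
  proof -
    have "(cmod (\<Sum>j<N. m i j * n i j * x j))\<^sup>2 \<le> (\<Sum>j<N. cmod (n i j) * cmod (m i j * x j))\<^sup>2"
      by (intro power_mono sum_norm_le) (simp_all add: norm_mult)
    also have "\<dots> \<le> (\<Sum>j<N. (cmod (n i j))\<^sup>2) * (\<Sum>j<N. (cmod (m i j * x j))\<^sup>2)"
      by (rule Cauchy_Schwarz_ineq_sum)
    also have "\<dots> \<le> L\<^sup>2 * (\<Sum>j<N. (cmod (m i j * x j))\<^sup>2)"
      by (intro mult_right_mono matrix_bound_row[OF b] sum_nonneg) simp
    finally show ?thesis by (simp add: norm_mult power_mult_distrib)
  qed
  hence "(\<Sum>i<M. (cmod (\<Sum>j<N. m i j * n i j * x j))\<^sup>2)
      \<le> (\<Sum>i<M. L\<^sup>2 * (\<Sum>j<N. (cmod (m i j))\<^sup>2 * (cmod (x j))\<^sup>2))"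
    by (rule sum_mono)
  also have "\<dots> = L\<^sup>2 * (\<Sum>i<M. \<Sum>j<N. (cmod (m i j))\<^sup>2 * (cmod (x j))\<^sup>2)"
    by (simp add: sum_distrib_left)
  also have "\<dots> = L\<^sup>2 * (\<Sum>j<N. (\<Sum>i<M. (cmod (m i j))\<^sup>2) * (cmod (x j))\<^sup>2)"
    by (subst sum.swap) (simp add: sum_distrib_right)
  also have "\<dots> \<le> L\<^sup>2 * (\<Sum>j<N. K\<^sup>2 * (cmod (x j))\<^sup>2)"
    by (intro mult_left_mono sum_mono mult_right_mono
        matrix_bound_row[OF matrix_bound_transpose[OF a]]) simp_all
  finally show "(\<Sum>i<M. (cmod (\<Sum>j<N. m i j * n i j * x j))\<^sup>2)
      \<le> (K * L)\<^sup>2 * (\<Sum>j<N. (cmod (x j))\<^sup>2)"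
    by (simp add: sum_distrib_left power_mult_distrib mult_ac)
qed

lemma matrix_bound_obtain_bop:
  assumes m: "matrix_bound K m"
  shows "\<exists>c. \<forall>i j. entry c i j = m i j"
proof -
  have summ: "summable (\<lambda>j. m i j * coord x j)" for i x
  proof (rule summable_norm_cancel)
    have "summable (\<lambda>j. (cmod (m i j))\<^sup>2)"
      by (rule summableI_nonneg_bounded[of _ "K\<^sup>2"]) (simp_all add: matrix_bound_row[OF m])
    thus "summable (\<lambda>j. norm (m i j * coord x j))"
      unfolding norm_mult by (rule square_summable_prod) (rule summable_coord)
  qed
  define g where "g x i = (\<Sum>j. m i j * coord x j)" for x i
  have bnd: "(\<Sum>i<M. (cmod (g x i))\<^sup>2) \<le> (\<bar>K\<bar> * norm x)\<^sup>2" for x M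
  proof (rule LIMSEQ_le_const2)
    show "(\<lambda>N. \<Sum>i<M. (cmod (\<Sum>j<N. m i j * coord x j))\<^sup>2) \<longlonglongrightarrow> (\<Sum>i<M. (cmod (g x i))\<^sup>2)"
      unfolding g_def
      by (intro tendsto_sum tendsto_power tendsto_norm summable_LIMSEQ summ)
    have "(\<Sum>i<M. (cmod (\<Sum>j<N. m i j * coord x j))\<^sup>2) \<le> (\<bar>K\<bar> * norm x)\<^sup>2" for N
    proof -
      have "(\<Sum>j<N. (cmod (coord x j))\<^sup>2) \<le> (norm x)\<^sup>2"
        unfolding norm_ell2_sq by (rule sum_le_suminf) (simp_all add: summable_coord)
      hence "K\<^sup>2 * (\<Sum>j<N. (cmod (coord x j))\<^sup>2) \<le> K\<^sup>2 * (norm x)\<^sup>2"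
        by (rule mult_left_mono) simp
      with matrix_boundD[OF m, of "coord x" N M] show ?thesis
        by (simp add: power_mult_distrib)
    qed
    thus "\<exists>N0. \<forall>N\<ge>N0. (\<Sum>i<M. (cmod (\<Sum>j<N. m i j * coord x j))\<^sup>2) \<le> (\<bar>K\<bar> * norm x)\<^sup>2"
      by blast
  qed
  have sq: "summable (\<lambda>i. (cmod (g x i))\<^sup>2)" for x
    by (rule summableI_nonneg_bounded[of _ "(\<bar>K\<bar> * norm x)\<^sup>2"]) (simp_all add: bnd)
  define f where "f x = Abs_ell2 (g x)" for x
  have f: "coord (f x) = g x" for x
    unfolding f_def by (rule Abs_ell2_inverse) (simp add: sq)
  have add: "f (x + y) = f x + f y" for x y
    by (rule ell2_eqI)
       (simp add: f plus_ell2.rep_eq g_def distrib_left suminf_add summ)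
  have scale: "f (c *\<^sub>C x) = c *\<^sub>C f x" for c x
  proof (rule ell2_eqI)
    fix i
    have "(\<Sum>j. m i j * (c * coord x j)) = (\<Sum>j. c * (m i j * coord x j))"
      by (simp add: mult_ac)
    thus "coord (f (c *\<^sub>C x)) i = coord (c *\<^sub>C f x) i"
      by (simp add: f scaleC_ell2.rep_eq g_def suminf_mult summ)
  qed
  have nrm: "norm (f x) \<le> norm x * \<bar>K\<bar>" for x
  proof -
    have "(norm (f x))\<^sup>2 \<le> (\<bar>K\<bar> * norm x)\<^sup>2"
      unfolding norm_ell2_sq f by (rule suminf_le_const[OF sq bnd])
    hence "norm (f x) \<le> \<bar>K\<bar> * norm x"
      by (rule power2_le_imp_le) simp
    thus ?thesis by (simp add: mult.commute)
  qed
  have "bounded_linear f"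
    by (rule bounded_linear_intro[OF add _ nrm]) (simp add: scaleR_ell2_def scale)
  hence appf: "app (Abs_bop (Blinfun f)) = f"
    by (simp add: app.rep_eq Abs_bop_inverse bounded_linear_Blinfun_apply scale)
  have "entry (Abs_bop (Blinfun f)) i j = m i j" for i j
  proof -
    have "(\<Sum>k. m i k * coord (unit_vec j) k) = (\<Sum>k\<in>{j}. m i k * coord (unit_vec j) k)"
      by (rule suminf_finite) (auto simp: unit_vec.rep_eq)
    thus ?thesis
      by (simp add: entry_def appf cinner_unit_vec f g_def unit_vec.rep_eq)
  qed
  thus ?thesis by blast
qed

lemma entry_schur: "entry (a \<^bold>* b) i j = entry a i j * entry b i j"
proof -
  have "\<exists>!c. \<forall>i j. entry c i j = entry a i j * entry b i j"
    using matrix_bound_obtain_bop[OF matrix_bound_schur[OF matrix_bound_entry matrix_bound_entry]]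
    by (metis bop_eqI)
  from theI'[OF this] show ?thesis unfolding schur_def by blast
qed

lemma entry_transpose_op: "entry (transpose_op a) i j = entry a j i"
proof -
  have "\<exists>!c. \<forall>i j. entry c i j = entry a j i"
    using matrix_bound_obtain_bop[OF matrix_bound_transpose[OF matrix_bound_entry]]
    by (metis bop_eqI)
  from theI'[OF this] show ?thesis unfolding transpose_op_def by blast
qed

end

theory Submission
  imports Defs
begin

text \<open>
  For the Schur product, \<open>B(\<ell>\<^sup>2)\<close> is a commutative algebra of functions on the index set
  \<open>\<nat> \<times> \<nat>\<close> under pointwise multiplication, and its minimal idempotents are the matrix units. A
  Schur multiplicative linear bijection therefore permutes the matrix units, and it merely
  relocates entries: \<open>(T a)\<^sub>k\<^sub>l\<close> is the entry of \<open>a\<close> at \<open>\<psi> (k, l)\<close>, for a bijection \<open>\<psi>\<close> of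
  \<open>\<nat> \<times> \<nat>\<close> (\<open>schur_multiplicative_relocates_entries\<close>).

  Contractivity restricts \<open>\<psi>\<close>. The sum of two distinct matrix units has norm \<open>\<surd>2\<close> if they lie in a
  common row or column and norm \<open>1\<close> otherwise. Hence \<open>T\<close> cannot move two units without a common
  line onto a common line, which says that \<open>\<psi>\<close> maps collinear index pairs to collinear index pairs
  (\<open>contractive_relocation_preserves_collinear\<close>). The rest is combinatorics of the square grid: a
  bijection that preserves collinearity, even in this one direction only, permutes rows and
  columns separately, possibly after exchanging the two coordinates (\<open>bij_collinear_cases\<close>). In
  terms of operators, the two permutations are multiplication by permutation unitaries on either
  side, and the exchange is the transpose.

  Conversely, multiplication by permutation unitaries and transposition relocate entries and
  do not increase the norm.
\<close>


section \<open>Bijections of a square grid that preserve collinearity\<close>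

definition collinear_idx :: "'a \<times> 'b \<Rightarrow> 'a \<times> 'b \<Rightarrow> bool" where
  "collinear_idx p q \<longleftrightarrow> fst p = fst q \<or> snd p = snd q"

text \<open>
  Two points of the family in different rows share a column, and a point outside that column would
  have to lie in both of their rows.
\<close>

lemma pairwise_collinear_cases:
  assumes "\<And>x y. collinear_idx (f x) (f y)"
  shows "(\<forall>x y. fst (f x) = fst (f y)) \<or> (\<forall>x y. snd (f x) = snd (f y))"
  using assms unfolding collinear_idx_def by metis

text \<open>
  A row going into a row and another going into a column would meet every column in a pair of collinear images, one of which has to
  be the single crossing point; injectivity allows this for one column only. Two rows going into
  the same row would drag every column, and so the whole grid, into that row. Thus distinct rows go
  to distinct rows, and collinearity then keeps each column in a column.
\<close>

lemma bij_collinear_row_to_row: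
  fixes \<psi> :: "'a \<times> 'a \<Rightarrow> 'a \<times> 'a"
  assumes \<psi>: "bij \<psi>"
    and col: "\<And>p q. collinear_idx p q \<Longrightarrow> collinear_idx (\<psi> p) (\<psi> q)"
    and k0: "\<And>l l'. fst (\<psi> (k0, l)) = fst (\<psi> (k0, l'))"
  shows "\<exists>r c. bij r \<and> bij c \<and> (\<forall>k l. \<psi> (k, l) = (r k, c l))"
proof -
  have inj: "\<psi> p = \<psi> q \<longleftrightarrow> p = q" for p q
    using \<psi> by (meson bij_is_inj inj_eq)
  have row: "(\<forall>l l'. fst (\<psi> (k, l)) = fst (\<psi> (k, l'))) \<or>
      (\<forall>l l'. snd (\<psi> (k, l)) = snd (\<psi> (k, l')))" for k
    by (rule pairwise_collinear_cases, rule col) (simp add: collinear_idx_def)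
  have column: "(\<forall>k k'. fst (\<psi> (k, l)) = fst (\<psi> (k', l))) \<or>
      (\<forall>k k'. snd (\<psi> (k, l)) = snd (\<psi> (k', l)))" for l
    by (rule pairwise_collinear_cases, rule col) (simp add: collinear_idx_def)
  have rows: "fst (\<psi> (k, l)) = fst (\<psi> (k, l'))" for k l l'
  proof (rule ccontr)
    assume ne: "fst (\<psi> (k, l)) \<noteq> fst (\<psi> (k, l'))"
    hence s: "snd (\<psi> (k, m)) = snd (\<psi> (k, m'))" for m m'
      using row[of k] by blast
    have "k \<noteq> k0" using ne k0 by blast
    \<comment> \<open>\<open>z\<close> is where the image row of \<open>k0\<close> crosses the image column of \<open>k\<close>; the second index is
      immaterial in both terms.\<close>
    define z where "z = (fst (\<psi> (k0, k)), snd (\<psi> (k, k)))"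
    have cross: "\<psi> (k0, m) = z \<or> \<psi> (k, m) = z" for m
    proof -
      have "collinear_idx (\<psi> (k0, m)) (\<psi> (k, m))"
        by (rule col) (simp add: collinear_idx_def)
      moreover have "fst (\<psi> (k0, m)) = fst z" "snd (\<psi> (k, m)) = snd z"
        unfolding z_def using k0[of m k] s[of m k] by simp_all
      ultimately show ?thesis
        unfolding collinear_idx_def by (metis prod_eqI)
    qed
    \<comment> \<open>Two distinct columns are enough for a contradiction, and \<open>k\<close>, \<open>k0\<close> serve as their indices.\<close>
    from cross[of k] cross[of k0] \<open>k \<noteq> k0\<close> show False
      by (metis inj prod.inject)
  qed
  have rinj: "k = k'" if eq: "fst (\<psi> (k, m)) = fst (\<psi> (k', m))" for k k' m
  proof (rule ccontr)
    assume "k \<noteq> k'"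
    have all: "fst (\<psi> (n, l)) = fst (\<psi> (k, m))" for n l
    proof -
      have e: "fst (\<psi> (k, l)) = fst (\<psi> (k', l))"
        using eq rows[of k l m] rows[of k' l m] by simp
      hence "snd (\<psi> (k, l)) \<noteq> snd (\<psi> (k', l))"
        using \<open>k \<noteq> k'\<close> inj[of "(k, l)" "(k', l)"] by (auto simp: prod_eq_iff)
      hence "fst (\<psi> (n, l)) = fst (\<psi> (k, l))"
        using column[of l] by blast
      thus ?thesis using rows[of k l m] by simp
    qed
    have "fst y = fst (\<psi> (k, m))" for y :: "'a \<times> 'a"
    proof -
      obtain n l where "y = \<psi> (n, l)" using \<psi> by (metis bij_pointE surj_pair)
      thus ?thesis using all[of n l] by simp
    qed
    from this[of "(k, k)"] this[of "(k', k)"] have "k = k'" by simp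
    with \<open>k \<noteq> k'\<close> show False by blast
  qed
  have cols: "snd (\<psi> (k, l)) = snd (\<psi> (k', l))" for k k' l
    using column[of l] rinj[of k l k'] by blast
  define r where "r k = fst (\<psi> (k, k0))" for k
  define c where "c l = snd (\<psi> (k0, l))" for l
  have form: "\<psi> (k, l) = (r k, c l)" for k l
    unfolding r_def c_def using rows[of k l k0] cols[of k l k0] by (simp add: prod_eq_iff)
  have "inj r"
    using inj[of "(k, k0)" "(k', k0)" for k k'] unfolding form by (simp add: inj_def)
  moreover have "inj c"
    using inj[of "(k0, l)" "(k0, l')" for l l'] unfolding form by (simp add: inj_def)
  moreover have "\<exists>k l. x = r k \<and> y = c l" for x y
    using \<psi> form by (metis bij_pointE surj_pair prod.inject)
  hence "surj r" "surj c"
    unfolding surj_def by blast+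
  ultimately show ?thesis
    using form unfolding bij_def by blast
qed

lemma bij_collinear_cases:
  fixes \<psi> :: "'a \<times> 'a \<Rightarrow> 'a \<times> 'a"
  assumes \<psi>: "bij \<psi>"
    and col: "\<And>p q. collinear_idx p q \<Longrightarrow> collinear_idx (\<psi> p) (\<psi> q)"
  obtains r c where "bij r" "bij c"
    "(\<forall>k l. \<psi> (k, l) = (r k, c l)) \<or> (\<forall>k l. \<psi> (k, l) = (c l, r k))"
proof -
  fix k0 :: 'a
  have "(\<forall>l l'. fst (\<psi> (k0, l)) = fst (\<psi> (k0, l'))) \<or>
      (\<forall>l l'. snd (\<psi> (k0, l)) = snd (\<psi> (k0, l')))"
    by (rule pairwise_collinear_cases, rule col) (simp add: collinear_idx_def)
  thus ?thesis
  proof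
    assume "\<forall>l l'. fst (\<psi> (k0, l)) = fst (\<psi> (k0, l'))"
    with bij_collinear_row_to_row[OF \<psi> col] that show ?thesis by blast
  next
    assume *: "\<forall>l l'. snd (\<psi> (k0, l)) = snd (\<psi> (k0, l'))"
    have "\<exists>r c. bij r \<and> bij c \<and> (\<forall>k l. (prod.swap \<circ> \<psi>) (k, l) = (r k, c l))"
    proof (rule bij_collinear_row_to_row)
      show "bij (prod.swap \<circ> \<psi>)"
        using \<psi> by (intro bij_comp bij_swap)
      show "collinear_idx ((prod.swap \<circ> \<psi>) p) ((prod.swap \<circ> \<psi>) q)" if "collinear_idx p q" for p q
        using col[OF that] by (auto simp: collinear_idx_def)
      show "fst ((prod.swap \<circ> \<psi>) (k0, l)) = fst ((prod.swap \<circ> \<psi>) (k0, l'))" for l l'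
        using * by simp
    qed
    then obtain r c where "bij r" "bij c" "\<And>k l. prod.swap (\<psi> (k, l)) = (r k, c l)"
      by auto
    moreover from this have "\<psi> (k, l) = (c l, r k)" for k l
      by (metis swap_simp swap_swap)
    ultimately show ?thesis using that by blast
  qed
qed


section \<open>Norms and matrices\<close>

text \<open>
  The Schur test with row and column sums bounded by \<open>1\<close>: apply the Cauchy--Schwarz inequality to
  \<open>\<bar>m\<^sub>i\<^sub>j x\<^sub>j\<bar> = \<surd>\<bar>m\<^sub>i\<^sub>j\<bar> \<cdot> (\<surd>\<bar>m\<^sub>i\<^sub>j\<bar> \<bar>x\<^sub>j\<bar>)\<close> in each row, then sum along the columns.
\<close>

lemma matrix_bound_schur_test:
  assumes row: "\<And>i N. (\<Sum>j<N. cmod (m i j)) \<le> 1"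
    and column: "\<And>j M. (\<Sum>i<M. cmod (m i j)) \<le> 1"
  shows "matrix_bound 1 m"
  unfolding matrix_bound_def
proof (intro allI)
  fix x :: "nat \<Rightarrow> complex" and M N :: nat
  have "(cmod (\<Sum>j<N. m i j * x j))\<^sup>2 \<le> (\<Sum>j<N. cmod (m i j) * (cmod (x j))\<^sup>2)" for i
  proof -
    have sqrt: "sqrt (cmod w) * (sqrt (cmod w) * y) = cmod w * y" for w y
      by (metis abs_norm_cancel mult.assoc real_sqrt_mult_self)
    have "(cmod (\<Sum>j<N. m i j * x j))\<^sup>2
        \<le> (\<Sum>j<N. sqrt (cmod (m i j)) * (sqrt (cmod (m i j)) * cmod (x j)))\<^sup>2"
      by (intro power_mono sum_norm_le) (simp_all only: norm_mult sqrt norm_ge_zero order_refl)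
    also have "\<dots> \<le> (\<Sum>j<N. (sqrt (cmod (m i j)))\<^sup>2) * (\<Sum>j<N. (sqrt (cmod (m i j)) * cmod (x j))\<^sup>2)"
      by (rule Cauchy_Schwarz_ineq_sum)
    also have "\<dots> = (\<Sum>j<N. cmod (m i j)) * (\<Sum>j<N. cmod (m i j) * (cmod (x j))\<^sup>2)"
      by (simp add: power_mult_distrib)
    also have "\<dots> \<le> 1 * (\<Sum>j<N. cmod (m i j) * (cmod (x j))\<^sup>2)"
      by (intro mult_right_mono row sum_nonneg) simp
    finally show ?thesis by simp
  qed
  hence "(\<Sum>i<M. (cmod (\<Sum>j<N. m i j * x j))\<^sup>2) \<le> (\<Sum>i<M. \<Sum>j<N. cmod (m i j) * (cmod (x j))\<^sup>2)"
    by (rule sum_mono)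
  also have "\<dots> = (\<Sum>j<N. (\<Sum>i<M. cmod (m i j)) * (cmod (x j))\<^sup>2)"
    by (subst sum.swap) (simp add: sum_distrib_right)
  also have "\<dots> \<le> (\<Sum>j<N. 1 * (cmod (x j))\<^sup>2)"
    by (intro sum_mono mult_right_mono column) simp
  finally show "(\<Sum>i<M. (cmod (\<Sum>j<N. m i j * x j))\<^sup>2) \<le> 1\<^sup>2 * (\<Sum>j<N. (cmod (x j))\<^sup>2)"
    by simp
qed

lemma norm_bop_le:
  assumes "0 \<le> K" and "\<And>x. norm (app a x) \<le> K * norm x"
  shows "norm a \<le> K"
  unfolding norm_bop_eq_onorm using assms by (rule onorm_bound)

text \<open>
  The bound on finite sections passes to \<open>a x\<close> in two limits, first in the number of columns and
  then in the number of rows.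
\<close>

lemma norm_le_if_matrix_bound:
  assumes m: "matrix_bound K (entry a)" and K: "0 \<le> K"
  shows "norm a \<le> K"
proof (rule norm_bop_le[OF K])
  fix x
  have "(\<Sum>i<M. (cmod (coord (app a x) i))\<^sup>2) \<le> (K * norm x)\<^sup>2" for M
  proof (rule LIMSEQ_le_const2)
    show "(\<lambda>N. \<Sum>i<M. (cmod (\<Sum>j<N. entry a i j * coord x j))\<^sup>2)
        \<longlonglongrightarrow> (\<Sum>i<M. (cmod (coord (app a x) i))\<^sup>2)"
      using app_sums unfolding sums_def by (intro tendsto_sum tendsto_power tendsto_norm)
    have "(\<Sum>i<M. (cmod (\<Sum>j<N. entry a i j * coord x j))\<^sup>2) \<le> (K * norm x)\<^sup>2" for N
    proof -
      have "(\<Sum>j<N. (cmod (coord x j))\<^sup>2) \<le> (norm x)\<^sup>2"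
        unfolding norm_ell2_sq by (rule sum_le_suminf) (simp_all add: summable_coord)
      hence "K\<^sup>2 * (\<Sum>j<N. (cmod (coord x j))\<^sup>2) \<le> K\<^sup>2 * (norm x)\<^sup>2"
        by (rule mult_left_mono) simp
      with matrix_boundD[OF m, of "coord x" N M] show ?thesis
        by (simp add: power_mult_distrib)
    qed
    thus "\<exists>N0. \<forall>N\<ge>N0. (\<Sum>i<M. (cmod (\<Sum>j<N. entry a i j * coord x j))\<^sup>2) \<le> (K * norm x)\<^sup>2"
      by blast
  qed
  hence "(norm (app a x))\<^sup>2 \<le> (K * norm x)\<^sup>2"
    unfolding norm_ell2_sq[of "app a x"] by (intro suminf_le_const summable_coord)
  thus "norm (app a x) \<le> K * norm x"
    by (rule power2_le_imp_le) (simp add: K)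
qed

lemma norm_transpose_op_le: "norm (transpose_op a) \<le> norm a"
proof (rule norm_le_if_matrix_bound)
  show "matrix_bound (norm a) (entry (transpose_op a))"
    unfolding entry_transpose_op[abs_def]
    by (rule matrix_bound_transpose) (rule matrix_bound_entry)
qed simp

lemma entry_zero: "entry 0 i j = 0"
  unfolding entry_def by transfer (simp add: cinner_unit_vec zero_ell2.rep_eq)

lemma entry_scaleC: "entry (c *\<^sub>C a) i j = c * entry a i j"
  unfolding entry_def
  by transfer (simp add: cinner_unit_vec scaleC_ell2.rep_eq blinfun_scaleC.rep_eq)

lemma scaleR_bop_eq_scaleC: "r *\<^sub>R a = complex_of_real r *\<^sub>C (a :: bop)"
  by transfer (rule blinfun_eqI,
    simp add: blinfun.scaleR_left scaleR_ell2_def blinfun_scaleC.rep_eq)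


section \<open>Zero-one matrices without collinear entries\<close>

definition no_collinear :: "(nat \<times> nat) set \<Rightarrow> bool" where
  "no_collinear S \<longleftrightarrow> (\<forall>p\<in>S. \<forall>q\<in>S. collinear_idx p q \<longrightarrow> p = q)"

text \<open>
  The operator with entry \<open>1\<close> on \<open>S\<close> and \<open>0\<close> elsewhere, which is bounded when \<open>S\<close> contains no two
  collinear pairs. Singletons give the matrix units, two-element sets the sums of
  two matrix units, and graphs of permutations the permutation unitaries.
\<close>

definition zero_one_op :: "(nat \<times> nat) set \<Rightarrow> bop" where
  "zero_one_op S = (SOME a. \<forall>i j. entry a i j = of_bool ((i, j) \<in> S))"

lemma sum_of_bool_le_one:
  assumes "finite A" and "\<And>x y. P x \<Longrightarrow> P y \<Longrightarrow> x = y"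
  shows "(\<Sum>x\<in>A. of_bool (P x)) \<le> (1 :: real)"
proof -
  have "card (A \<inter> {x. P x}) \<le> 1"
    using assms by (intro card_le_Suc0_iff_eq[THEN iffD2, folded One_nat_def]) auto
  moreover have "(\<Sum>x\<in>A. of_bool (P x)) = real (card (A \<inter> {x. P x}))"
    using assms(1) by simp
  ultimately show ?thesis by linarith
qed

lemma matrix_bound_zero_one:
  assumes "no_collinear S"
  shows "matrix_bound 1 (\<lambda>i j. of_bool ((i, j) \<in> S))"
proof -
  have sum_le: "(\<Sum>k\<in>A. cmod (of_bool (P k))) \<le> 1"
    if A: "finite A" and P: "\<And>x y. P x \<Longrightarrow> P y \<Longrightarrow> x = y" for A :: "nat set" and P
  proof -
    have "cmod (of_bool (P k)) = of_bool (P k)" for k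
      by (cases "P k") auto
    hence "(\<Sum>k\<in>A. cmod (of_bool (P k))) = (\<Sum>k\<in>A. of_bool (P k))"
      by (intro sum.cong refl)
    also have "\<dots> \<le> 1"
      using A P by (rule sum_of_bool_le_one)
    finally show ?thesis .
  qed
  have S: "i = k \<and> j = l" if "(i, j) \<in> S" "(k, l) \<in> S" "i = k \<or> j = l" for i j k l
    using assms that unfolding no_collinear_def collinear_idx_def by fastforce
  show ?thesis
  proof (rule matrix_bound_schur_test)
    show "(\<Sum>j<N. cmod (of_bool ((i, j) \<in> S))) \<le> 1" for i N
      by (rule sum_le[OF finite_lessThan]) (use S in blast)
    show "(\<Sum>i<M. cmod (of_bool ((i, j) \<in> S))) \<le> 1" for j M
      by (rule sum_le[OF finite_lessThan]) (use S in blast)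
  qed
qed

lemma entry_zero_one_op:
  assumes "no_collinear S"
  shows "entry (zero_one_op S) i j = of_bool ((i, j) \<in> S)"
proof -
  have "\<exists>a. \<forall>i j. entry a i j = of_bool ((i, j) \<in> S)"
    by (rule matrix_bound_obtain_bop) (rule matrix_bound_zero_one[OF assms])
  thus ?thesis unfolding zero_one_op_def by (rule someI2_ex) blast
qed

lemma norm_zero_one_op:
  assumes "no_collinear S"
  shows "norm (zero_one_op S) \<le> 1"
  using matrix_bound_zero_one[OF assms]
  by (intro norm_le_if_matrix_bound) (simp_all add: entry_zero_one_op[OF assms, abs_def])

abbreviation matrix_unit :: "nat \<times> nat \<Rightarrow> bop" where
  "matrix_unit p \<equiv> zero_one_op {p}"

lemma entry_matrix_unit: "entry (matrix_unit p) i j = of_bool ((i, j) = p)"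
  by (simp add: entry_zero_one_op no_collinear_def)

lemma matrix_unit_inject: "matrix_unit p = matrix_unit q \<longleftrightarrow> p = q"
proof
  assume "matrix_unit p = matrix_unit q"
  hence "entry (matrix_unit p) (fst p) (snd p) = entry (matrix_unit q) (fst p) (snd p)"
    by simp
  thus "p = q" by (simp add: entry_matrix_unit split: if_splits)
qed simp

lemma schur_matrix_unit: "matrix_unit p \<^bold>* a = entry a (fst p) (snd p) *\<^sub>C matrix_unit p"
  by (rule bop_eqI) (auto simp: entry_schur entry_scaleC entry_matrix_unit)


section \<open>Schur multiplicative bijections relocate entries\<close>

text \<open>
  The minimal idempotents of the Schur algebra, described by the product and the linear structure
  alone, so that a multiplicative linear bijection preserves them in both directions.
\<close>

definition minimal_schur_idempotent :: "bop \<Rightarrow> bool" where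
  "minimal_schur_idempotent p \<longleftrightarrow> p \<noteq> 0 \<and> p \<^bold>* p = p \<and> (\<forall>a. \<exists>c. p \<^bold>* a = c *\<^sub>C p)"

text \<open>
  Schur multiplication by a matrix unit at a nonzero position of a minimal idempotent \<open>p\<close> cuts \<open>p\<close>
  down to that position, but the result is a multiple of \<open>p\<close>; so \<open>p\<close> has only one nonzero entry,
  which is \<open>1\<close> by idempotence.
\<close>

lemma minimal_schur_idempotent_iff: "minimal_schur_idempotent p \<longleftrightarrow> (\<exists>q. p = matrix_unit q)"
proof
  assume p: "minimal_schur_idempotent p"
  then obtain i j where nz: "entry p i j \<noteq> 0"
    unfolding minimal_schur_idempotent_def by (metis bop_eqI entry_zero)
  have one: "entry p i j = 1"
    using p nz unfolding minimal_schur_idempotent_def by (metis entry_schur mult_cancel_left2)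
  from p obtain c where c: "p \<^bold>* matrix_unit (i, j) = c *\<^sub>C p"
    unfolding minimal_schur_idempotent_def by blast
  have e: "entry p k l * of_bool ((k, l) = (i, j)) = c * entry p k l" for k l
    using arg_cong[OF c, of "\<lambda>a. entry a k l"]
    by (simp add: entry_schur entry_scaleC entry_matrix_unit)
  from e[of i j] one have "c = 1" by simp
  with e one have "p = matrix_unit (i, j)"
    by (intro bop_eqI) (auto simp: entry_matrix_unit split: if_splits)
  thus "\<exists>q. p = matrix_unit q" by blast
next
  assume "\<exists>q. p = matrix_unit q"
  then obtain q where q: "p = matrix_unit q" by blast
  have "entry p (fst q) (snd q) \<noteq> entry 0 (fst q) (snd q)"
    by (simp add: q entry_matrix_unit entry_zero)
  hence "p \<noteq> 0" by blast
  moreover have "p \<^bold>* p = p"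
    by (rule bop_eqI) (simp add: q entry_schur entry_matrix_unit)
  ultimately show "minimal_schur_idempotent p"
    unfolding minimal_schur_idempotent_def using schur_matrix_unit q by blast
qed

lemma schur_multiplicative_preserves_minimal:
  assumes lin: "complex_linear T" and bij: "bij T" and mult: "schur_multiplicative T"
  shows "minimal_schur_idempotent (T p) \<longleftrightarrow> minimal_schur_idempotent p"
proof -
  interpret T: Vector_Spaces.linear scaleC scaleC T by (rule lin)
  have inj: "T a = T b \<longleftrightarrow> a = b" for a b
    using bij by (meson bij_is_inj inj_eq)
  have m: "T a \<^bold>* T b = T (a \<^bold>* b)" for a b
    using mult by (simp add: schur_multiplicative_def)
  have "T p \<noteq> 0 \<longleftrightarrow> p \<noteq> 0"
    using inj[of p 0] by (simp add: T.zero)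
  moreover have "T p \<^bold>* T p = T p \<longleftrightarrow> p \<^bold>* p = p"
    by (simp add: m inj)
  moreover have "(\<forall>b. \<exists>c. T p \<^bold>* b = c *\<^sub>C T p) \<longleftrightarrow> (\<forall>a. \<exists>c. p \<^bold>* a = c *\<^sub>C p)"
  proof -
    have "(\<forall>b. \<exists>c. T p \<^bold>* b = c *\<^sub>C T p) \<longleftrightarrow> (\<forall>a. \<exists>c. T p \<^bold>* T a = c *\<^sub>C T p)"
      using bij by (metis bij_pointE)
    thus ?thesis by (simp add: m inj flip: T.scale)
  qed
  ultimately show ?thesis
    unfolding minimal_schur_idempotent_def by blast
qed

text \<open>
  Define \<open>\<psi>\<close> by \<open>T E\<^bsub>\<psi> q\<^esub> = E\<^sub>q\<close> on the matrix units \<open>E\<^sub>q\<close>, and compare the entries at \<open>q\<close> on both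
  sides of \<open>E\<^sub>q * T a = T (E\<^bsub>\<psi> q\<^esub> * a)\<close>.
\<close>

lemma schur_multiplicative_relocates_entries:
  assumes lin: "complex_linear T" and bij: "bij T" and mult: "schur_multiplicative T"
  obtains \<psi> where "bij \<psi>"
    "\<And>a k l. entry (T a) k l = entry a (fst (\<psi> (k, l))) (snd (\<psi> (k, l)))"
proof -
  interpret T: Vector_Spaces.linear scaleC scaleC T by (rule lin)
  note minimal = schur_multiplicative_preserves_minimal[OF lin bij mult]
  have "\<exists>p. T (matrix_unit p) = matrix_unit q" for q
    using bij minimal minimal_schur_idempotent_iff by (metis bij_pointE)
  then obtain \<psi> where \<psi>: "\<And>q. T (matrix_unit (\<psi> q)) = matrix_unit q"
    by metis
  show thesis
  proof (rule that[of \<psi>])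
    show "bij \<psi>"
    proof (rule bijI)
      show "inj \<psi>" by (metis \<psi> injI matrix_unit_inject)
      have "\<exists>q. T (matrix_unit p) = matrix_unit q" for p
        using minimal minimal_schur_idempotent_iff by metis
      thus "surj \<psi>"
        using \<psi> bij by (metis bij_is_inj inj_eq matrix_unit_inject surjI)
    qed
    fix a and k l :: nat
    let ?q = "(k, l)"
    have "matrix_unit ?q \<^bold>* T a = T (matrix_unit (\<psi> ?q) \<^bold>* a)"
      using mult \<psi> unfolding schur_multiplicative_def by metis
    also have "\<dots> = entry a (fst (\<psi> ?q)) (snd (\<psi> ?q)) *\<^sub>C matrix_unit ?q"
      by (simp add: schur_matrix_unit T.scale \<psi>)
    finally have "entry (T a) k l *\<^sub>C matrix_unit ?q
        = entry a (fst (\<psi> ?q)) (snd (\<psi> ?q)) *\<^sub>C matrix_unit ?q"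
      by (simp add: schur_matrix_unit)
    from arg_cong[OF this, of "\<lambda>b. entry b k l"]
    show "entry (T a) k l = entry a (fst (\<psi> ?q)) (snd (\<psi> ?q))"
      by (simp add: entry_scaleC entry_matrix_unit)
  qed
qed

text \<open>
  The matrix with ones at \<open>\<psi> p\<close> and \<open>\<psi> q\<close> has norm at most \<open>1\<close> if these two positions share no
  line. Its image has ones at \<open>p\<close> and \<open>q\<close>, and would have a row or column of norm \<open>\<surd>2\<close> if
  \<open>p\<close> and \<open>q\<close> were distinct and collinear.
\<close>

lemma contractive_relocation_preserves_collinear:
  assumes \<psi>: "inj \<psi>"
    and T: "\<And>a k l. entry (T a) k l = entry a (fst (\<psi> (k, l))) (snd (\<psi> (k, l)))"
    and contr: "\<And>a. norm (T a) \<le> norm a"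
    and pq: "collinear_idx p q"
  shows "collinear_idx (\<psi> p) (\<psi> q)"
proof (cases "p = q")
  case True
  thus ?thesis by (simp add: collinear_idx_def)
next
  case False
  show ?thesis
  proof (rule ccontr)
    assume "\<not> collinear_idx (\<psi> p) (\<psi> q)"
    hence nc: "no_collinear {\<psi> p, \<psi> q}"
      by (auto simp: no_collinear_def collinear_idx_def)
    define b where "b = T (zero_one_op {\<psi> p, \<psi> q})"
    have eb: "entry b k l = of_bool ((k, l) \<in> {p, q})" for k l
      using \<psi> by (auto simp: b_def T entry_zero_one_op[OF nc] inj_eq)
    have "norm b \<le> 1"
      unfolding b_def using contr norm_zero_one_op[OF nc] by (rule order_trans)
    hence b1: "(norm b)\<^sup>2 \<le> 1" by (simp add: abs_square_le_1)
    have row: "(\<Sum>j<N. (cmod (entry b i j))\<^sup>2) \<le> 1" for i N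
      using matrix_bound_row[OF matrix_bound_entry] b1 by (rule order_trans)
    have column: "(\<Sum>i<N. (cmod (entry b i j))\<^sup>2) \<le> 1" for j N
      using matrix_bound_row[OF matrix_bound_transpose[OF matrix_bound_entry]] b1
      by (rule order_trans)
    obtain i j i' j' where ij: "p = (i, j)" "q = (i', j')" by fastforce
    have two: False if "x \<noteq> y" "f x = 1" "f y = 1" "\<And>n. 0 \<le> f n" "\<And>N. (\<Sum>n<N. f n) \<le> 1"
      for x y :: nat and f :: "nat \<Rightarrow> real"
    proof -
      have "(\<Sum>n\<in>{x, y}. f n) \<le> (\<Sum>n<Suc (max x y). f n)"
        by (rule sum_mono2) (use that(4) in auto)
      with that(5)[of "Suc (max x y)"] that(1-3) show False by simp
    qed
    from pq consider "i = i'" "j \<noteq> j'" | "j = j'" "i \<noteq> i'"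
      using False ij by (auto simp: collinear_idx_def)
    thus False
    proof cases
      case 1
      show False
      proof (rule two[OF 1(2)])
        show "(\<Sum>n<N. (cmod (entry b i n))\<^sup>2) \<le> 1" for N by (rule row)
      qed (simp_all add: eb ij 1(1))
    next
      case 2
      show False
      proof (rule two[OF 2(2)])
        show "(\<Sum>n<N. (cmod (entry b n j))\<^sup>2) \<le> 1" for N by (rule column)
      qed (simp_all add: eb ij 2(1))
    qed
  qed
qed


section \<open>Permutation unitaries\<close>

lemma coord_app_permutation:
  assumes \<pi>: "bij \<pi>" and u: "\<And>i j. entry u i j = of_bool (i = \<pi> j)"
  shows "coord (app u x) (\<pi> n) = coord x n"
proof -
  have "(\<lambda>j. if j = n then coord x n else 0) sums coord x n"
    by (rule sums_single)
  moreover have "entry u (\<pi> n) j * coord x j = (if j = n then coord x n else 0)" for j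
    using \<pi> by (auto simp: u bij_is_inj inj_eq)
  ultimately show ?thesis
    using app_sums[of u "\<pi> n" x] sums_unique2 by simp
qed

text \<open>
  The defining series of the inner product converges absolutely, so it does not
  change when the coordinates are permuted.
\<close>

lemma cinner_permute_coords:
  assumes \<pi>: "bij \<pi>"
    and x: "\<And>n. coord x' (\<pi> n) = coord x n" and y: "\<And>n. coord y' (\<pi> n) = coord y n"
  shows "cinner x' y' = cinner x y"
proof -
  have abs: "summable (\<lambda>n. norm (coord v n * cnj (coord w n)))" for v w
    by (simp add: norm_mult square_summable_prod summable_coord)
  have inf: "cinner v w = (\<Sum>\<^sub>\<infinity>n. coord v n * cnj (coord w n))" for v w
    unfolding cinner_def
    by (rule infsumI[symmetric], rule norm_summable_imp_has_sum)
       (rule abs summable_sums summable_cinner)+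
  have "cinner x' y' = (\<Sum>\<^sub>\<infinity>n. coord x' (\<pi> n) * cnj (coord y' (\<pi> n)))"
    unfolding inf by (rule infsum_reindex_bij_betw[OF \<pi>, symmetric])
  thus ?thesis by (simp add: inf x y)
qed

lemma permutation_unitary_exists:
  assumes \<pi>: "bij \<pi>"
  obtains u where "permutation_unitary u" "\<And>i. app u (unit_vec i) = unit_vec (\<pi> i)"
proof -
  have "no_collinear {(\<rho> j, j) | j. True}" if "bij \<rho>" for \<rho>
    using that by (auto simp: no_collinear_def collinear_idx_def bij_is_inj inj_eq)
  from entry_zero_one_op[OF this] have "\<exists>u. \<forall>i j. entry u i j = of_bool (i = \<rho> j)"
    if "bij \<rho>" for \<rho>
    using that by fastforce
  then obtain u w where u: "\<And>i j. entry u i j = of_bool (i = \<pi> j)"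
    and w: "\<And>i j. entry w i j = of_bool (i = inv \<pi> j)"
    using \<pi> bij_imp_bij_inv[OF \<pi>] by metis
  note cu = coord_app_permutation[OF \<pi> u]
  have cw: "coord (app w x) n = coord x (\<pi> n)" for x n
    using coord_app_permutation[OF bij_imp_bij_inv[OF \<pi>] w, of x "\<pi> n"] \<pi>
    by (simp add: bij_is_inj)
  have "app u (app w y) = y" for y
  proof (rule ell2_eqI)
    fix n
    obtain m where "n = \<pi> m" using \<pi> by (metis bij_pointE)
    thus "coord (app u (app w y)) n = coord y n" by (simp add: cu cw)
  qed
  hence "surj (app u)" by (metis surjI)
  moreover have "cinner (app u x) (app u y) = cinner x y" for x y
    by (rule cinner_permute_coords[OF \<pi>]) (rule cu)+
  ultimately have "unitary_op u" by (simp add: unitary_op_def)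
  moreover have e: "app u (unit_vec i) = unit_vec (\<pi> i)" for i
  proof (rule ell2_eqI)
    fix n
    obtain m where "n = \<pi> m" using \<pi> by (metis bij_pointE)
    thus "coord (app u (unit_vec i)) n = coord (unit_vec (\<pi> i)) n"
      using \<pi> by (simp add: cu unit_vec.rep_eq bij_is_inj inj_eq)
  qed
  ultimately have "permutation_unitary u"
    unfolding permutation_unitary_def using \<pi> by blast
  with e that show thesis by blast
qed

text \<open>On the left, move \<open>u\<close> to the other argument of the inner product by unitarity.\<close>

lemma entry_permutation_conj:
  assumes u: "unitary_op u" "\<And>i. app u (unit_vec i) = unit_vec (\<pi> i)"
    and v: "\<And>i. app v (unit_vec i) = unit_vec (\<sigma> i)"
  shows "entry (u o\<^sub>B a o\<^sub>B v) (\<pi> i) j = entry a i (\<sigma> j)"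
proof -
  have "entry (u o\<^sub>B a o\<^sub>B v) (\<pi> i) j = cinner (app u (app a (unit_vec (\<sigma> j)))) (app u (unit_vec i))"
    by (simp add: entry_def app_op_compose u(2) v)
  also have "\<dots> = entry a i (\<sigma> j)"
    using u(1) by (simp add: unitary_op_def entry_def)
  finally show ?thesis .
qed

lemma norm_app_unitary:
  assumes "unitary_op u"
  shows "norm (app u x) = norm x"
  using assms by (simp add: norm_eq_sqrt_inner inner_eq_Re_cinner unitary_op_def)

lemma norm_unitary_conj_le:
  assumes "unitary_op u" "unitary_op v"
  shows "norm (u o\<^sub>B a o\<^sub>B v) \<le> norm a"
proof (rule norm_bop_le)
  fix x
  have "norm (app a (app v x)) \<le> norm a * norm (app v x)"
    by (rule norm_app_le)
  thus "norm (app (u o\<^sub>B a o\<^sub>B v) x) \<le> norm a * norm x"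
    by (simp add: app_op_compose norm_app_unitary assms)
qed simp


section \<open>The characterization\<close>

lemma contractive_if_norm_le:
  assumes lin: "complex_linear T" and le: "\<And>a. norm (T a) \<le> norm a"
  shows "contractive T"
proof -
  interpret T: Vector_Spaces.linear scaleC scaleC T by (rule lin)
  have "bounded_linear T"
    by (rule bounded_linear_intro[of T 1])
       (simp_all add: T.add T.scale scaleR_bop_eq_scaleC le)
  moreover have "onorm T \<le> 1"
    by (rule onorm_bound) (simp_all add: le)
  ultimately show ?thesis by (simp add: contractive_def)
qed

lemma norm_le_if_contractive:
  assumes "contractive T"
  shows "norm (T a) \<le> norm a"
proof -
  have "norm (T a) \<le> onorm T * norm a"
    using assms by (simp add: contractive_def onorm)
  also have "\<dots> \<le> 1 * norm a"
    using assms by (intro mult_right_mono) (simp_all add: contractive_def)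
  finally show ?thesis by simp
qed

lemma schur_multiplicative_if_relocation:
  assumes "\<And>a k l. entry (T a) k l = entry a (f k l) (g k l)"
  shows "schur_multiplicative T"
  unfolding schur_multiplicative_def by (intro allI bop_eqI) (simp add: assms entry_schur)

lemma permutation_conj_contractive_multiplicative:
  assumes lin: "complex_linear T"
    and u: "permutation_unitary u" and v: "permutation_unitary v"
    and T: "(\<forall>a. T a = u o\<^sub>B a o\<^sub>B v) \<or> (\<forall>a. T a = u o\<^sub>B transpose_op a o\<^sub>B v)"
  shows "contractive T \<and> schur_multiplicative T"
proof
  obtain \<pi> where uu: "unitary_op u" and \<pi>: "bij \<pi>"
    and ue: "\<And>i. app u (unit_vec i) = unit_vec (\<pi> i)"
    using u unfolding permutation_unitary_def by blast
  obtain \<sigma> where vu: "unitary_op v" and ve: "\<And>i. app v (unit_vec i) = unit_vec (\<sigma> i)"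
    using v unfolding permutation_unitary_def by blast
  have "norm (T a) \<le> norm a" for a
    using T norm_unitary_conj_le[OF uu vu] norm_transpose_op_le by (metis order_trans)
  with lin show "contractive T" by (rule contractive_if_norm_le)
  have e: "entry (u o\<^sub>B a o\<^sub>B v) k l = entry a (inv \<pi> k) (\<sigma> l)" for a k l
    using entry_permutation_conj[OF uu ue ve, of a "inv \<pi> k" l] \<pi>
    by (simp add: bij_is_surj surj_f_inv_f)
  from T show "schur_multiplicative T"
  proof
    assume "\<forall>a. T a = u o\<^sub>B a o\<^sub>B v"
    thus ?thesis
      by (intro schur_multiplicative_if_relocation[of T "\<lambda>k l. inv \<pi> k" "\<lambda>k l. \<sigma> l"]) (simp add: e)
  next
    assume "\<forall>a. T a = u o\<^sub>B transpose_op a o\<^sub>B v"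
    thus ?thesis
      by (intro schur_multiplicative_if_relocation[of T "\<lambda>k l. \<sigma> l" "\<lambda>k l. inv \<pi> k"])
         (simp add: e entry_transpose_op)
  qed
qed

theorem theorem2p5:
  fixes T :: "bop \<Rightarrow> bop"
  assumes "complex_linear T" and "bij T"
  shows "contractive T \<and> schur_multiplicative T \<longleftrightarrow>
    (\<exists>u v. permutation_unitary u \<and> permutation_unitary v \<and>
      ((\<forall>a. T a = u o\<^sub>B a o\<^sub>B v) \<or> (\<forall>a. T a = u o\<^sub>B transpose_op a o\<^sub>B v)))"
proof
  assume *: "contractive T \<and> schur_multiplicative T"
  then obtain \<psi> where \<psi>: "bij \<psi>"
    and T: "\<And>a k l. entry (T a) k l = entry a (fst (\<psi> (k, l))) (snd (\<psi> (k, l)))"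
    using schur_multiplicative_relocates_entries[OF assms] by metis
  have "collinear_idx (\<psi> p) (\<psi> q)" if "collinear_idx p q" for p q
    using contractive_relocation_preserves_collinear[OF bij_is_inj[OF \<psi>] T _ that]
      norm_le_if_contractive * by blast
  then obtain r c where r: "bij r" and c: "bij c"
    and form: "(\<forall>k l. \<psi> (k, l) = (r k, c l)) \<or> (\<forall>k l. \<psi> (k, l) = (c l, r k))"
    using bij_collinear_cases[OF \<psi>] by metis
  \<comment> \<open>Row \<open>k\<close> of \<open>T a\<close> is taken from line \<open>r k\<close>, so \<open>u\<close> has to move \<open>e\<^bsub>r k\<^esub>\<close> to \<open>e\<^sub>k\<close>.\<close>
  obtain u where u: "permutation_unitary u" and ue: "\<And>i. app u (unit_vec i) = unit_vec (inv r i)"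
    using permutation_unitary_exists[OF bij_imp_bij_inv[OF r]] by metis
  obtain v where v: "permutation_unitary v" and ve: "\<And>i. app v (unit_vec i) = unit_vec (c i)"
    using permutation_unitary_exists[OF c] by metis
  have "unitary_op u" using u by (simp add: permutation_unitary_def)
  from entry_permutation_conj[OF this ue ve, of _ "r k" for k]
  have e: "entry (u o\<^sub>B a o\<^sub>B v) k l = entry a (r k) (c l)" for a k l
    using r by (simp add: bij_is_inj)
  from form have "(\<forall>a. T a = u o\<^sub>B a o\<^sub>B v) \<or> (\<forall>a. T a = u o\<^sub>B transpose_op a o\<^sub>B v)"
  proof
    assume "\<forall>k l. \<psi> (k, l) = (r k, c l)"
    hence "\<forall>a. T a = u o\<^sub>B a o\<^sub>B v"
      by (intro allI bop_eqI) (simp add: T e)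
    thus ?thesis ..
  next
    assume "\<forall>k l. \<psi> (k, l) = (c l, r k)"
    hence "\<forall>a. T a = u o\<^sub>B transpose_op a o\<^sub>B v"
      by (intro allI bop_eqI) (simp add: T e entry_transpose_op)
    thus ?thesis ..
  qed
  with u v show "\<exists>u v. permutation_unitary u \<and> permutation_unitary v \<and>
      ((\<forall>a. T a = u o\<^sub>B a o\<^sub>B v) \<or> (\<forall>a. T a = u o\<^sub>B transpose_op a o\<^sub>B v))"
    by blast
next
  assume "\<exists>u v. permutation_unitary u \<and> permutation_unitary v \<and>
      ((\<forall>a. T a = u o\<^sub>B a o\<^sub>B v) \<or> (\<forall>a. T a = u o\<^sub>B transpose_op a o\<^sub>B v))"
  thus "contractive T \<and> schur_multiplicative T"
    using permutation_conj_contractive_multiplicative[OF assms(1)] by blast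
qed

end
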